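(* Let $r,s\geq1$ be integers and let $\mathcal{A}$ and $\mathcal{B}$ be square matrices, both $N\times N$ with $N\in\mathbb{N}$ or both infinite with rows and columns indexed by $\mathbb{Z}_+$, which are semi-separable of ranks $s$ and $r$ respectively. If the matrices are infinite, assume that the product $\mathcal{A}\mathcal{B}$ is bounded in the sense that the series $\sum_{k=0}^\infty\mathcal{A}_{m,k}\mathcal{B}_{k,n}$ defining its entries converge for all $m,n\in\mathbb{Z}_+$. Then $\mathcal{A}\mathcal{B}$ is semi-separable of rank at most $r+s$.
   Context: $\mathbb{Z}_+=\{0,1,2,\ldots\}$; matrices have real or complex entries. A (finite or infinite) matrix is semi-separable of rank $r\geq1$ if every submatrix lying wholly (strictly) above or wholly (strictly) below the main diagonal has rank $\leq r$. The product of infinite matrices is defined entrywise by $(\mathcal{A}\mathcal{B})_{m,n}=\sum_{k=0}^\infty\mathcal{A}_{m,k}\mathcal{B}_{k,n}$. *)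

theory Defs
  imports "HOL-Analysis.Analysis" "HOL-Library.Function_Algebras" "HOL-Library.Extended_Nat"
begin

text \<open>
  A square matrix is a function of type \<^typ>\<open>nat \<Rightarrow> nat \<Rightarrow> 'a\<close> together with a size
  \<^term>\<open>N :: enat\<close>: rows and columns are indexed by \<open>{0, \<dots>, N - 1}\<close> if \<open>N\<close> is finite and
  by all natural numbers if \<^prop>\<open>N = \<infinity>\<close>. Values outside the index range are irrelevant.
  Entries are real or complex: up to isomorphism these are the only instances of the class
  \<^class>\<open>real_normed_field\<close>.
\<close>

definition indices :: "enat \<Rightarrow> nat set" where
  "indices N = {i. enat i < N}"

definition mat_prod ::
    "enat \<Rightarrow> (nat \<Rightarrow> nat \<Rightarrow> 'a::real_normed_field) \<Rightarrow> (nat \<Rightarrow> nat \<Rightarrow> 'a) \<Rightarrow> nat \<Rightarrow> nat \<Rightarrow> 'a" where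
  "mat_prod N A B = (\<lambda>m n. case N of
      enat d \<Rightarrow> (\<Sum>k<d. A m k * B k n)
    | \<infinity> \<Rightarrow> (\<Sum>k. A m k * B k n))"

definition seq_scale :: "'a::field \<Rightarrow> (nat \<Rightarrow> 'a) \<Rightarrow> nat \<Rightarrow> 'a" where
  "seq_scale c f = (\<lambda>j. c * f j)"

interpretation seq: vector_space "seq_scale :: 'a::field \<Rightarrow> (nat \<Rightarrow> 'a) \<Rightarrow> nat \<Rightarrow> 'a"
  by unfold_locales (auto simp: seq_scale_def fun_eq_iff algebra_simps)

text \<open>
  The rows of the submatrix with row set \<open>I\<close> and column set \<open>J\<close>, as vectors indexed by \<open>J\<close>;
  such a vector is represented by its extension by zero.
\<close>

definition submatrix_rows ::
    "(nat \<Rightarrow> nat \<Rightarrow> 'a::field) \<Rightarrow> nat set \<Rightarrow> nat set \<Rightarrow> (nat \<Rightarrow> 'a) set" where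
  "submatrix_rows M I J = (\<lambda>i j. if j \<in> J then M i j else 0) ` I"

text \<open>
  The rank is the dimension of the row space. Submatrices of infinite matrices may be infinite, and
  the library's \<^const>\<open>seq.dim\<close> is 0 on infinite-dimensional spaces, so that case is
  separated out.
\<close>

definition submatrix_rank ::
    "(nat \<Rightarrow> nat \<Rightarrow> 'a::field) \<Rightarrow> nat set \<Rightarrow> nat set \<Rightarrow> enat" where
  "submatrix_rank M I J =
    (if \<exists>F. finite F \<and> submatrix_rows M I J \<subseteq> seq.span F
     then enat (seq.dim (submatrix_rows M I J)) else \<infinity>)"

definition semi_separable :: "enat \<Rightarrow> nat \<Rightarrow> (nat \<Rightarrow> nat \<Rightarrow> 'a::field) \<Rightarrow> bool" where
  "semi_separable N r M \<longleftrightarrow>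
    (\<forall>I J. I \<subseteq> indices N \<and> J \<subseteq> indices N \<and>
       ((\<forall>i\<in>I. \<forall>j\<in>J. i < j) \<or> (\<forall>i\<in>I. \<forall>j\<in>J. j < i)) \<longrightarrow>
       submatrix_rank M I J \<le> enat r)"

end

theory Submission
  imports Defs
begin

text \<open>
  Split the product at a threshold \<open>p\<close> between the row set \<open>I\<close> and the column set \<open>J\<close>: the rows of
  \<open>AB\<close> on \<open>J\<close> are \<open>A[I, K] B[K, J] + A[I, L] B[L, J]\<close> where \<open>K\<close> and \<open>L\<close> are the indices below and
  from \<open>p\<close> on. Above the diagonal, \<open>B[K, J]\<close> and \<open>A[I, L]\<close> lie strictly above the diagonal; below
  the diagonal, \<open>A[I, K]\<close> and \<open>B[L, J]\<close> lie strictly below it. In either case one summand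
  has rank at most \<open>r\<close> and the other at most \<open>s\<close>. The infinite sums are harmless: a finite linear
  relation between rows of \<open>A\<close> passes through convergent sums, and an infinite sum of rows
  of \<open>B[L, J]\<close> with \<open>J\<close> finite stays in their span because finite-dimensional spaces are closed.
\<close>

lemma sum_fun_apply: "sum f S x = (\<Sum>i\<in>S. f i x)"
  for f :: "'b \<Rightarrow> 'c \<Rightarrow> 'd::comm_monoid_add"
  by (induction S rule: infinite_finite_induct) auto

text \<open>The spanning set is chosen among the rows themselves: convergence against
  \<open>B\<close> is assumed only for rows of \<open>A\<close>, not for arbitrary vectors that span
  them.\<close>

lemma submatrix_rank_leD:
  assumes "submatrix_rank M I J \<le> enat r"
  obtains F where "finite F" "card F \<le> r" "F \<subseteq> submatrix_rows M I J"
    "submatrix_rows M I J \<subseteq> seq.span F"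
proof -
  let ?V = "submatrix_rows M I J"
  obtain G where G: "finite G" "?V \<subseteq> seq.span G" and dim: "seq.dim ?V \<le> r"
    using assms by (auto simp: submatrix_rank_def split: if_splits)
  obtain F where F: "F \<subseteq> ?V" "seq.independent F" "?V \<subseteq> seq.span F" "card F = seq.dim ?V"
    using seq.basis_exists by blast
  have "finite F"
    using seq.independent_span_bound[OF G(1) F(2)] F(1) G(2) by blast
  then show ?thesis
    using F dim that by auto
qed

lemma submatrix_rank_leI:
  assumes "finite F" "card F \<le> r" "submatrix_rows M I J \<subseteq> seq.span F"
  shows "submatrix_rank M I J \<le> enat r"
  using assms seq.dim_le_card[OF assms(3,1)] by (auto simp: submatrix_rank_def)

text \<open>The row vector \<open>u\<close> times the columns of \<open>B\<close> in
  \<open>J\<close>, extended by zero to match \<open>submatrix_rows\<close>. It is meaningful only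
  where the series converge.\<close>

definition row_mult ::
    "nat set \<Rightarrow> (nat \<Rightarrow> 'a::real_normed_field) \<Rightarrow> (nat \<Rightarrow> nat \<Rightarrow> 'a) \<Rightarrow> nat \<Rightarrow> 'a" where
  "row_mult J u B = (\<lambda>j. if j \<in> J then \<Sum>k. u k * B k j else 0)"

lemma row_mult_in_span_image:
  assumes "u \<in> seq.span F" and "\<And>v j. v \<in> F \<Longrightarrow> j \<in> J \<Longrightarrow> summable (\<lambda>k. v k * B k j)"
  shows "row_mult J u B \<in> seq.span ((\<lambda>v. row_mult J v B) ` F)"
proof -
  \<comment> \<open>Summability joins the induction claim, since \<open>suminf\<close> is additive
    only on convergent series.\<close>
  have "(\<forall>j\<in>J. summable (\<lambda>k. u k * B k j)) \<and>
    row_mult J u B \<in> seq.span ((\<lambda>v. row_mult J v B) ` F)"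
    using assms(1)
  proof (induction rule: seq.span_induct_alt)
    case base
    have zero: "row_mult J 0 B = 0"
      by (auto simp: row_mult_def)
    show ?case
      unfolding zero by (intro conjI seq.span_zero) simp
  next
    case (step c x y)
    have sx: "summable (\<lambda>k. x k * B k j)" and sy: "summable (\<lambda>k. y k * B k j)" if "j \<in> J" for j
      using step assms(2) that by auto
    have eq: "(seq_scale c x + y) k * B k j = c * (x k * B k j) + y k * B k j" for k j
      by (simp add: seq_scale_def algebra_simps)
    have "row_mult J (seq_scale c x + y) B = seq_scale c (row_mult J x B) + row_mult J y B"
      unfolding row_mult_def eq
      by (auto simp: fun_eq_iff seq_scale_def suminf_add[symmetric] suminf_mult sx sy summable_mult)
    moreover have "\<forall>j\<in>J. summable (\<lambda>k. (seq_scale c x + y) k * B k j)"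
      unfolding eq using sx sy by (auto intro!: summable_add summable_mult)
    moreover have "seq_scale c (row_mult J x B) + row_mult J y B
        \<in> seq.span ((\<lambda>v. row_mult J v B) ` F)"
      using step by (intro seq.span_add seq.span_scale[OF seq.span_base] imageI) auto
    ultimately show ?case
      by (simp only: simp_thms)
  qed
  then show ?thesis ..
qed

text \<open>With finite support the series is a finite sum of rows, so \<open>J\<close> may be
  infinite.\<close>

lemma row_mult_in_span_rows_finite:
  assumes "finite K" and "\<And>k. k \<notin> K \<Longrightarrow> u k = 0"
  shows "row_mult J u B \<in> seq.span (submatrix_rows B K J)"
proof -
  have "(\<Sum>k. u k * B k j) = (\<Sum>k\<in>K. u k * B k j)" for j
    using assms by (intro suminf_finite) auto
  then have "row_mult J u B = (\<Sum>k\<in>K. seq_scale (u k) (\<lambda>j. if j \<in> J then B k j else 0))"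
    by (auto simp: row_mult_def fun_eq_iff sum_fun_apply seq_scale_def)
  also have "\<dots> \<in> seq.span (submatrix_rows B K J)"
    by (intro seq.span_sum seq.span_scale seq.span_base) (auto simp: submatrix_rows_def)
  finally show ?thesis .
qed

text \<open>A basis of the span stays independent when \<open>v\<close> is added, so values on it
  can be prescribed freely. This replaces a topological closedness argument.\<close>

lemma exists_separating_functional:
  fixes v :: "nat \<Rightarrow> 'a::field"
  assumes "v \<notin> seq.span S"
  obtains f where "Vector_Spaces.linear seq_scale (*) f" "f v = 1" "\<And>w. w \<in> S \<Longrightarrow> f w = 0"
proof -
  interpret vector_space_pair "seq_scale :: 'a \<Rightarrow> _" "(*) :: 'a \<Rightarrow> 'a \<Rightarrow> 'a"
    by unfold_locales (auto simp: algebra_simps)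
  obtain F where F: "F \<subseteq> S" "seq.independent F" "S \<subseteq> seq.span F"
    using seq.maximal_independent_subset by blast
  have "v \<notin> seq.span F"
    using assms seq.span_mono[OF F(1)] by blast
  then have "seq.independent (insert v F)"
    using F(2) by (simp add: seq.independent_insert)
  then obtain f where f: "Vector_Spaces.linear seq_scale (*) f"
      "\<forall>x\<in>insert v F. f x = (if x = v then 1 else 0)"
    using linear_independent_extend[of "insert v F" "\<lambda>x. if x = v then 1 else 0"] by blast
  have "f w = 0" if "w \<in> S" for w
  proof (rule linear_eq_0_on_span[OF f(1)])
    show "w \<in> seq.span F"
      using that F(3) by blast
    show "f x = 0" if "x \<in> F" for x
      using that f(2) \<open>v \<notin> seq.span F\<close> seq.span_base by auto
  qed
  with f that show ?thesis
    by auto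
qed

text \<open>A functional that kills all rows also kills their convergent infinite combinations, so
  none can separate \<open>row_mult J u B\<close> from the span.\<close>

lemma row_mult_in_span_rows:
  fixes B :: "nat \<Rightarrow> nat \<Rightarrow> 'a::real_normed_field"
  assumes "finite J" and "\<And>k. k \<notin> K \<Longrightarrow> u k = 0"
    and summable: "\<And>j. j \<in> J \<Longrightarrow> summable (\<lambda>k. u k * B k j)"
  shows "row_mult J u B \<in> seq.span (submatrix_rows B K J)"
proof (rule ccontr)
  assume "row_mult J u B \<notin> seq.span (submatrix_rows B K J)"
  then obtain f where f: "Vector_Spaces.linear seq_scale (*) f" "f (row_mult J u B) = 1"
    "\<And>w. w \<in> submatrix_rows B K J \<Longrightarrow> f w = 0"
    using exists_separating_functional by blast
  interpret f: Vector_Spaces.linear "seq_scale :: 'a \<Rightarrow> _" "(*) :: 'a \<Rightarrow> 'a \<Rightarrow> 'a" f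
    by (fact f(1))
  define e :: "nat \<Rightarrow> nat \<Rightarrow> 'a" where "e j = (\<lambda>i. if i = j then 1 else 0)" for j
  \<comment> \<open>On vectors supported in the finite set \<open>J\<close>, \<open>f\<close> is a
    finite combination of coordinates and hence commutes with convergent series.\<close>
  have f_eq: "f (\<lambda>j. if j \<in> J then w j else 0) = (\<Sum>j\<in>J. w j * f (e j))" for w
  proof -
    have "(\<lambda>j. if j \<in> J then w j else 0) = (\<Sum>j\<in>J. seq_scale (w j) (e j))"
      using \<open>finite J\<close> by (auto simp: fun_eq_iff sum_fun_apply seq_scale_def e_def if_distrib cong: if_cong)
    then show ?thesis
      by (simp add: f.sum f.scale)
  qed
  have rows: "u k * (\<Sum>j\<in>J. B k j * f (e j)) = 0" for k
    using f(3)[of "\<lambda>j. if j \<in> J then B k j else 0"] assms(2)[of k] f_eq[of "B k"]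
    by (cases "k \<in> K") (auto simp: submatrix_rows_def)
  have "f (row_mult J u B) = (\<Sum>j\<in>J. (\<Sum>k. u k * B k j) * f (e j))"
    unfolding row_mult_def by (rule f_eq)
  also have "\<dots> = (\<Sum>j\<in>J. \<Sum>k. u k * B k j * f (e j))"
    by (intro sum.cong refl suminf_mult2 summable)
  also have "\<dots> = (\<Sum>k. \<Sum>j\<in>J. u k * B k j * f (e j))"
    by (intro suminf_sum[symmetric] summable_mult2 summable)
  also have "\<dots> = 0"
    using rows by (simp add: sum_distrib_left mult.assoc)
  finally show False
    using f(2) by simp
qed

text \<open>The \<open>L\<close> part inherits its rank from the rows of \<open>A\<close>, the
  \<open>K\<close> part from those of \<open>B\<close>. Only the \<open>K\<close> part forms
  possibly infinite combinations of rows, hence the finiteness condition.\<close>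

lemma submatrix_rank_mult_le:
  fixes A B :: "nat \<Rightarrow> nat \<Rightarrow> 'a::real_normed_field"
  assumes A: "submatrix_rank A I L \<le> enat s" and B: "submatrix_rank B K J \<le> enat r"
    and disj: "K \<inter> L = {}" and fin: "finite K \<or> finite J"
    and summable: "\<And>i j. i \<in> I \<Longrightarrow> j \<in> J \<Longrightarrow> summable (\<lambda>k. if k \<in> K then A i k * B k j else 0)"
      "\<And>i j. i \<in> I \<Longrightarrow> j \<in> J \<Longrightarrow> summable (\<lambda>k. if k \<in> L then A i k * B k j else 0)"
  shows "submatrix_rank (\<lambda>i j. \<Sum>k. if k \<in> K \<union> L then A i k * B k j else 0) I J \<le> enat (r + s)"
proof -
  define row where "row X i k = (if k \<in> X then A i k else 0)" for X i k
  have row_mult: "row X i k * B k j = (if k \<in> X then A i k * B k j else 0)" for X i k j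
    by (simp add: row_def)
  obtain F where F: "finite F" "card F \<le> s" "F \<subseteq> submatrix_rows A I L"
      "submatrix_rows A I L \<subseteq> seq.span F"
    using submatrix_rank_leD[OF A] .
  obtain G where G: "finite G" "card G \<le> r" "submatrix_rows B K J \<subseteq> seq.span G"
    using submatrix_rank_leD[OF B] .
  define H where "H = (\<lambda>v. row_mult J v B) ` F"
  have rows_L: "submatrix_rows A I L = row L ` I"
    unfolding submatrix_rows_def by (intro image_cong) (auto simp: row_def)
  have "row_mult J (row L i) B \<in> seq.span H" if "i \<in> I" for i
    unfolding H_def
  proof (rule row_mult_in_span_image)
    show "row L i \<in> seq.span F"
      using that F(4) rows_L by blast
    \<comment> \<open>Each \<open>v\<close> in \<open>F\<close> is a row of \<open>A\<close> cut
      down to \<open>L\<close>, so its series is among those assumed to converge.\<close>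
    show "summable (\<lambda>k. v k * B k j)" if "v \<in> F" "j \<in> J" for v j
      using that F(3) summable(2) unfolding rows_L by (auto simp: row_mult)
  qed
  moreover have "row_mult J (row K i) B \<in> seq.span G" if "i \<in> I" for i
  proof -
    have "row_mult J (row K i) B \<in> seq.span (submatrix_rows B K J)"
      using fin
    proof
      assume "finite K"
      then show ?thesis
        by (rule row_mult_in_span_rows_finite) (simp add: row_def)
    next
      assume "finite J"
      then show ?thesis
        by (rule row_mult_in_span_rows) (use summable(1) that in \<open>auto simp: row_mult\<close>, simp add: row_def)
    qed
    also have "\<dots> \<subseteq> seq.span G"
      using G(3) by (rule seq.span_minimal) (rule seq.subspace_span)
    finally show ?thesis .
  qed
  ultimately have in_span: "row_mult J (row K i) B + row_mult J (row L i) B \<in> seq.span (G \<union> H)"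
    if "i \<in> I" for i
    using that seq.span_mono[of G "G \<union> H"] seq.span_mono[of H "G \<union> H"]
    by (intro seq.span_add) auto
  have split: "(if k \<in> K \<union> L then A i k * B k j else 0) =
      (if k \<in> K then A i k * B k j else 0) + (if k \<in> L then A i k * B k j else 0)" for i j k
    using disj by auto
  have "(\<lambda>j. if j \<in> J then \<Sum>k. if k \<in> K \<union> L then A i k * B k j else 0 else 0) =
      row_mult J (row K i) B + row_mult J (row L i) B" if "i \<in> I" for i
    using that unfolding split
    by (auto simp: fun_eq_iff row_mult_def row_mult suminf_add summable)
  then have "submatrix_rows (\<lambda>i j. \<Sum>k. if k \<in> K \<union> L then A i k * B k j else 0) I J
      \<subseteq> seq.span (G \<union> H)"
    unfolding submatrix_rows_def by (intro image_subsetI) (simp only: in_span)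
  moreover have "card (G \<union> H) \<le> r + s"
    using card_Un_le[of G H] G(2) F(2) card_image_le[OF F(1), of "\<lambda>v. row_mult J v B"]
    unfolding H_def by linarith
  ultimately show ?thesis
    using F(1) G(1) by (intro submatrix_rank_leI[of "G \<union> H"]) (auto simp: H_def)
qed

lemma submatrix_rank_empty:
  assumes "I = {} \<or> J = {}"
  shows "submatrix_rank M I J \<le> enat r"
proof (rule submatrix_rank_leI[of "{}"])
  have "(\<lambda>j. 0) = (0 :: nat \<Rightarrow> 'a)"
    by (simp add: fun_eq_iff)
  then show "submatrix_rows M I J \<subseteq> seq.span {}"
    using assms by (auto simp: submatrix_rows_def)
qed auto

text \<open>Masking by \<open>indices N\<close> turns both sizes into one kind of series.\<close>

lemma mat_prod_eq_suminf:
  "mat_prod N A B m n = (\<Sum>k. if k \<in> indices N then A m k * B k n else 0)"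
proof (cases N)
  case (enat d)
  have "(\<Sum>k. if k < d then A m k * B k n else 0) = (\<Sum>k<d. if k < d then A m k * B k n else 0)"
    by (rule suminf_finite) auto
  then show ?thesis
    by (simp add: enat mat_prod_def indices_def)
qed (simp add: mat_prod_def indices_def)

theorem theorem3p3:
  fixes A B :: "nat \<Rightarrow> nat \<Rightarrow> 'a::real_normed_field"
    and N :: enat and r s :: nat
  assumes "r \<ge> 1" and "s \<ge> 1"
    and "semi_separable N s A"
    and "semi_separable N r B"
    and "N = \<infinity> \<Longrightarrow> \<forall>m n. summable (\<lambda>k. A m k * B k n)"
  shows "semi_separable N (r + s) (mat_prod N A B)"
  unfolding semi_separable_def
proof (intro allI impI)
  fix I J
  assume IJ: "I \<subseteq> indices N \<and> J \<subseteq> indices N \<and>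
    ((\<forall>i\<in>I. \<forall>j\<in>J. i < j) \<or> (\<forall>i\<in>I. \<forall>j\<in>J. j < i))"
  have low: "summable (\<lambda>k. if k \<in> indices N \<inter> {..<p} then A m k * B k n else 0)" for p m n
    by (rule summable_finite[of "{..<p}"]) auto
  have all: "summable (\<lambda>k. if k \<in> indices N then A m k * B k n else 0)" for m n
  proof (cases N)
    case (enat d)
    then show ?thesis
      by (intro summable_finite[of "{..<d}"]) (auto simp: indices_def)
  next
    case infinity
    then show ?thesis
      using assms(5) by (simp add: indices_def)
  qed
  \<comment> \<open>From \<open>p\<close> on the terms agree with those of the full series.\<close>
  have high: "summable (\<lambda>k. if k \<in> indices N \<inter> {p..} then A m k * B k n else 0)" for p m n
    by (rule summable_cong[THEN iffD2, OF eventually_mono[OF eventually_ge_at_top[of p]] all[of m n]])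
      auto
  have disjoint: "indices N \<inter> {..<p} \<inter> (indices N \<inter> {p..}) = {}"
    "indices N \<inter> {p..} \<inter> (indices N \<inter> {..<p}) = {}" for p
    by auto
  have un: "indices N \<inter> {..<p} \<union> indices N \<inter> {p..} = indices N"
    "indices N \<inter> {p..} \<union> indices N \<inter> {..<p} = indices N" for p
    by auto
  \<comment> \<open>Empty sets are split off because the threshold is a least element of
    \<open>J\<close> or \<open>I\<close>.\<close>
  consider "I = {} \<or> J = {}" | "I \<noteq> {}" "J \<noteq> {}" "\<forall>i\<in>I. \<forall>j\<in>J. i < j"
    | "I \<noteq> {}" "J \<noteq> {}" "\<forall>i\<in>I. \<forall>j\<in>J. j < i"
    using IJ by blast
  then show "submatrix_rank (mat_prod N A B) I J \<le> enat (r + s)"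
  proof cases
    case 1
    then show ?thesis
      by (rule submatrix_rank_empty)
  next
    case 2
    \<comment> \<open>Both factors are strictly above the diagonal: \<open>i < p \<le> k\<close> in
      \<open>A\<close>, and \<open>k < p \<le> j\<close> in \<open>B\<close>. The row set taken from
      \<open>B\<close> is finite.\<close>
    define p where "p = (LEAST j. j \<in> J)"
    have p: "p \<in> J" "\<And>j. j \<in> J \<Longrightarrow> p \<le> j"
      using 2(2) by (auto simp: p_def intro: LeastI Least_le)
    have "submatrix_rank A I (indices N \<inter> {p..}) \<le> enat s"
      using assms(3) IJ 2(3) p(1) unfolding semi_separable_def
      by (metis Int_iff atLeast_iff inf_le1 order_less_le_trans)
    moreover have "submatrix_rank B (indices N \<inter> {..<p}) J \<le> enat r"
      using assms(4) IJ p(2) unfolding semi_separable_def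
      by (metis Int_iff lessThan_iff inf_le1 order_less_le_trans)
    ultimately show ?thesis
      using submatrix_rank_mult_le[of A I "indices N \<inter> {p..}" s B "indices N \<inter> {..<p}" J r,
          OF _ _ disjoint(1) _ low high]
      unfolding mat_prod_eq_suminf un by simp
  next
    case 3
    \<comment> \<open>Now \<open>k < p \<le> i\<close> in \<open>A\<close> and
      \<open>j < p \<le> k\<close> in \<open>B\<close>. The rows of \<open>B\<close> may be
      infinitely many, but \<open>J\<close> lies below \<open>p\<close> and is finite.\<close>
    define p where "p = (LEAST i. i \<in> I)"
    have p: "p \<in> I" "\<And>i. i \<in> I \<Longrightarrow> p \<le> i"
      using 3(1) by (auto simp: p_def intro: LeastI Least_le)
    have "submatrix_rank A I (indices N \<inter> {..<p}) \<le> enat s"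
      using assms(3) IJ p(2) unfolding semi_separable_def
      by (metis Int_iff lessThan_iff inf_le1 order_less_le_trans)
    moreover have "submatrix_rank B (indices N \<inter> {p..}) J \<le> enat r"
      using assms(4) IJ 3(3) p(1) unfolding semi_separable_def
      by (metis Int_iff atLeast_iff inf_le1 order_less_le_trans)
    moreover have "finite J"
      using 3(3) p(1) by (auto intro: finite_subset[of _ "{..<p}"])
    ultimately show ?thesis
      using submatrix_rank_mult_le[of A I "indices N \<inter> {..<p}" s B "indices N \<inter> {p..}" J r,
          OF _ _ disjoint(2) _ high low]
      unfolding mat_prod_eq_suminf un by simp
  qed
qed

end
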